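(* Let $\mathbf{B}$ be a category, and let $\mathbf{C},\mathbf{D},\mathbf{R},\mathbf{R}'$ be concrete categories over $\mathbf{B}$. Let $\gamma:\mathbf{D}\to\mathbf{C}$ be a concrete functor that has a weak left adjoint $\langle\alpha,\eta\rangle$. Let $H:\mathbf{D}\to\mathbf{D}$ and $\widetilde{H}:\mathbf{C}\to\mathbf{C}$ be concrete functors such that $\widetilde{H}\gamma=\gamma H$. Let $G:\mathbf{D}\to\mathbf{R}$, $F_1:\mathbf{R}\to\mathbf{R}'$ and $F_2:\mathbf{R}\to\mathbf{R}'$ be concrete functors. Suppose that $\mathbf{R}$ is fibred and that $F_2$ is a cartesian functor. Let $\overline{G}:\mathbf{C}\to\mathbf{R}$, $\overline{G}(A):=\eta_A^{-1}(G(\alpha(A)))$, be the lifting of $G$. If $F_1(G(H(d)))\preceq F_2(G(d))$ for all objects $d$ of $\mathbf{D}$, then $F_1(\overline{G}(\widetilde{H}(c)))\preceq F_2(\overline{G}(c))$ for all objects $c$ of $\mathbf{C}$.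
   Context: A concrete category over a category $\mathbf{B}$ is a category $\mathbf{C}$ together with a faithful functor $\phi_{\mathbf{C}}:\mathbf{C}\to\mathbf{B}$. For objects $A,B$ of $\mathbf{C}$ and $f\in\mathbf{B}(\phi_{\mathbf{C}}(A),\phi_{\mathbf{C}}(B))$, write $A\Vdash_f B$ if there is an arrow $g\in\mathbf{C}(A,B)$ with $\phi_{\mathbf{C}}(g)=f$. A functor $F:\mathbf{C}\to\mathbf{D}$ between concrete categories over $\mathbf{B}$ is concrete if $\phi_{\mathbf{C}}=\phi_{\mathbf{D}}\circ F$. For objects $C,C'$ of a concrete category $\mathbf{C}$, write $C\preceq C'$ if $\phi_{\mathbf{C}}(C)=\phi_{\mathbf{C}}(C')$ and $C\Vdash_{1}C'$ where $1$ is the identity of $\phi_{\mathbf{C}}(C)$. Weak left adjoint: for a concrete functor $\gamma:\mathbf{D}\to\mathbf{C}$, a weak left adjoint of $\gamma$ is a pair $\langle\alpha,\eta\rangle$ where $\alpha$ assigns to every object $A$ of $\mathbf{C}$ an object $\alpha(A)$ of $\mathbf{D}$ ($\alpha$ need not be a functor), and $\eta$ assigns to every object $A$ of $\mathbf{C}$ an arrow $\eta_A\in\mathbf{B}(\phi_{\mathbf{C}}(A),\phi_{\mathbf{D}}(\alpha(A)))$, such that (1) $A\Vdash_{\eta_A}\gamma(\alpha(A))$, and (2) for every object $K$ of $\mathbf{D}$ and every $f\in\mathbf{B}(\phi_{\mathbf{C}}(A),\phi_{\mathbf{D}}(K))$ with $A\Vdash_f\gamma(K)$, there is an arrow $\overline{f}\in\mathbf{B}(\phi_{\mathbf{D}}(\alpha(A)),\phi_{\mathbf{D}}(K))$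 (not necessarily unique) with $\alpha(A)\Vdash_{\overline{f}}K$ and $f=\overline{f}\circ\eta_A$. Cartesian arrows: let $\mathbf{C}$ be concrete over $\mathbf{B}$, $B$ an object of $\mathbf{C}$, and $f:X\to\phi_{\mathbf{C}}(B)$ an arrow of $\mathbf{B}$. An arrow $u\in\mathbf{C}(A,B)$ is cartesian (for $f$ and $B$) if $\phi_{\mathbf{C}}(A)=X$, $\phi_{\mathbf{C}}(u)=f$, and for every object $Z$ of $\mathbf{C}$ and every arrow $h:\phi_{\mathbf{C}}(Z)\to X$ of $\mathbf{B}$ with $Z\Vdash_{f\circ h}B$, we have $Z\Vdash_h A$. A concrete category $\mathbf{C}$ is fibred if every object $B$ and every arrow $f:X\to\phi_{\mathbf{C}}(B)$ of $\mathbf{B}$ has a cartesian arrow, and compositions of cartesian arrows are cartesian. For a fibred category a canonical choice of cartesian arrow for each $f$ and $B$ is fixed, and its domain is denoted $f^{-1}(B)$. A concrete functor is cartesian if it sends cartesian arrows to cartesian arrows. *)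

theory Defs
  imports Main
begin

section \<open>Categories and functors\<close>

record ('o, 'a) cat =
  Obj :: "'o set"
  Arr :: "'a set"
  Dom :: "'a \<Rightarrow> 'o"
  Cod :: "'a \<Rightarrow> 'o"
  Ident :: "'o \<Rightarrow> 'a"
  Comp :: "'a \<Rightarrow> 'a \<Rightarrow> 'a"  (infixl "\<bullet>\<index>" 70)

text \<open>Composition is in applicative order: \<open>g \<bullet> f\<close> is \<open>f\<close> followed by \<open>g\<close>.\<close>

definition hom :: "('o, 'a, 'm) cat_scheme \<Rightarrow> 'o \<Rightarrow> 'o \<Rightarrow> 'a set" where
  "hom C A B = {f \<in> Arr C. A \<in> Obj C \<and> B \<in> Obj C \<and> Dom C f = A \<and> Cod C f = B}"

locale category =
  fixes C :: "('o, 'a, 'm) cat_scheme" (structure)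
  assumes Dom_Obj: "f \<in> Arr C \<Longrightarrow> Dom C f \<in> Obj C"
    and Cod_Obj: "f \<in> Arr C \<Longrightarrow> Cod C f \<in> Obj C"
    and Ident_hom: "A \<in> Obj C \<Longrightarrow> Ident C A \<in> hom C A A"
    and Comp_hom: "f \<in> hom C X Y \<Longrightarrow> g \<in> hom C Y Z \<Longrightarrow> g \<bullet> f \<in> hom C X Z"
    and Comp_Ident: "f \<in> hom C X Y \<Longrightarrow> f \<bullet> Ident C X = f"
    and Ident_Comp: "f \<in> hom C X Y \<Longrightarrow> Ident C Y \<bullet> f = f"
    and Comp_assoc: "f \<in> hom C W X \<Longrightarrow> g \<in> hom C X Y \<Longrightarrow> h \<in> hom C Y Z \<Longrightarrow>
      (h \<bullet> g) \<bullet> f = h \<bullet> (g \<bullet> f)"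

record ('o, 'a, 'p, 'b) func =
  fobj :: "'o \<Rightarrow> 'p"
  farr :: "'a \<Rightarrow> 'b"

locale cat_functor = source: category C + target: category D
  for C :: "('o, 'a, 'm) cat_scheme" and D :: "('p, 'b, 'n) cat_scheme" +
  fixes F :: "('o, 'a, 'p, 'b) func"
  assumes farr_hom: "f \<in> hom C X Y \<Longrightarrow> farr F f \<in> hom D (fobj F X) (fobj F Y)"
    and fobj_Obj: "X \<in> Obj C \<Longrightarrow> fobj F X \<in> Obj D"
    and farr_Ident: "X \<in> Obj C \<Longrightarrow> farr F (Ident C X) = Ident D (fobj F X)"
    and farr_Comp: "f \<in> hom C X Y \<Longrightarrow> g \<in> hom C Y Z \<Longrightarrow>
      farr F (g \<bullet>\<^bsub>C\<^esub> f) = farr F g \<bullet>\<^bsub>D\<^esub> farr F f"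

definition func_comp ::
  "('p, 'b, 'q, 'c) func \<Rightarrow> ('o, 'a, 'p, 'b) func \<Rightarrow> ('o, 'a, 'q, 'c) func" where
  "func_comp G F = \<lparr>fobj = fobj G \<circ> fobj F, farr = farr G \<circ> farr F\<rparr>"

text \<open>Equality of functors out of \<open>C\<close>. The maps of a functor are total functions whose values
  outside \<open>Obj C\<close> and \<open>Arr C\<close> are irrelevant.\<close>

definition func_eq ::
  "('o, 'a, 'm) cat_scheme \<Rightarrow> ('o, 'a, 'p, 'b) func \<Rightarrow> ('o, 'a, 'p, 'b) func \<Rightarrow> bool" where
  "func_eq C F G \<longleftrightarrow>
    (\<forall>X\<in>Obj C. fobj F X = fobj G X) \<and> (\<forall>f\<in>Arr C. farr F f = farr G f)"


section \<open>Concrete categories\<close>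

record ('o, 'a, 'p, 'b) conc_cat = "('o, 'a) cat" +
  Forget :: "('o, 'a, 'p, 'b) func"

locale concrete_category =
  cat_functor C B "Forget C"
  for B :: "('p, 'b, 'n) cat_scheme" and C :: "('o, 'a, 'p, 'b, 'm) conc_cat_scheme" +
  assumes faithful: "u \<in> hom C X Y \<Longrightarrow> v \<in> hom C X Y \<Longrightarrow>
    farr (Forget C) u = farr (Forget C) v \<Longrightarrow> u = v"

abbreviation under :: "('o, 'a, 'p, 'b, 'm) conc_cat_scheme \<Rightarrow> 'o \<Rightarrow> 'p" where
  "under C \<equiv> fobj (Forget C)"

text \<open>\<open>forces C A f B\<close> is \<open>A \<tturnstile>\<^sub>f B\<close>; it implies that \<open>A\<close> and \<open>B\<close> are objects of \<open>C\<close>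
  and, if \<open>C\<close> is concrete over \<open>B'\<close>, that \<open>f\<close> lies in \<open>hom B' (under C A) (under C B)\<close>.\<close>

definition forces :: "('o, 'a, 'p, 'b, 'm) conc_cat_scheme \<Rightarrow> 'o \<Rightarrow> 'b \<Rightarrow> 'o \<Rightarrow> bool" where
  "forces C A f B \<longleftrightarrow> (\<exists>g\<in>hom C A B. farr (Forget C) g = f)"

definition below ::
  "('p, 'b, 'n) cat_scheme \<Rightarrow> ('o, 'a, 'p, 'b, 'm) conc_cat_scheme \<Rightarrow> 'o \<Rightarrow> 'o \<Rightarrow> bool" where
  "below B C X Y \<longleftrightarrow> under C X = under C Y \<and> forces C X (Ident B (under C X)) Y"

locale concrete_functor =
  source: concrete_category B C + target: concrete_category B D + cat_functor C D F
  for B :: "('p, 'b, 'n) cat_scheme"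
    and C :: "('o, 'a, 'p, 'b, 'm) conc_cat_scheme"
    and D :: "('q, 'c, 'p, 'b, 'k) conc_cat_scheme"
    and F :: "('o, 'a, 'q, 'c) func" +
  assumes over_base: "func_eq C (Forget C) (func_comp (Forget D) F)"

definition weak_left_adjoint ::
  "('p, 'b, 'n) cat_scheme \<Rightarrow> ('o, 'a, 'p, 'b, 'm) conc_cat_scheme \<Rightarrow>
   ('q, 'c, 'p, 'b, 'k) conc_cat_scheme \<Rightarrow> ('q, 'c, 'o, 'a) func \<Rightarrow>
   ('o \<Rightarrow> 'q) \<Rightarrow> ('o \<Rightarrow> 'b) \<Rightarrow> bool" where
  "weak_left_adjoint B C D \<gamma> \<alpha> \<eta> \<longleftrightarrow>
    (\<forall>A\<in>Obj C.
      \<alpha> A \<in> Obj D \<and>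
      \<eta> A \<in> hom B (under C A) (under D (\<alpha> A)) \<and>
      forces C A (\<eta> A) (fobj \<gamma> (\<alpha> A)) \<and>
      (\<forall>K\<in>Obj D. \<forall>f\<in>hom B (under C A) (under D K). forces C A f (fobj \<gamma> K) \<longrightarrow>
        (\<exists>f'\<in>hom B (under D (\<alpha> A)) (under D K).
          forces D (\<alpha> A) f' K \<and> f = f' \<bullet>\<^bsub>B\<^esub> \<eta> A)))"


section \<open>Cartesian arrows and fibred categories\<close>

definition cartesian_arrow ::
  "('p, 'b, 'n) cat_scheme \<Rightarrow> ('o, 'a, 'p, 'b, 'm) conc_cat_scheme \<Rightarrow>
   'b \<Rightarrow> 'o \<Rightarrow> 'a \<Rightarrow> bool" where
  "cartesian_arrow B C f Y u \<longleftrightarrow>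
    Y \<in> Obj C \<and> f \<in> Arr B \<and> Cod B f = under C Y \<and>
    u \<in> Arr C \<and> Cod C u = Y \<and> under C (Dom C u) = Dom B f \<and> farr (Forget C) u = f \<and>
    (\<forall>Z\<in>Obj C. \<forall>h\<in>hom B (under C Z) (Dom B f).
      forces C Z (f \<bullet>\<^bsub>B\<^esub> h) Y \<longrightarrow> forces C Z h (Dom C u))"

definition fibred ::
  "('p, 'b, 'n) cat_scheme \<Rightarrow> ('o, 'a, 'p, 'b, 'm) conc_cat_scheme \<Rightarrow> bool" where
  "fibred B C \<longleftrightarrow>
    (\<forall>Y\<in>Obj C. \<forall>f\<in>Arr B. Cod B f = under C Y \<longrightarrow> (\<exists>u. cartesian_arrow B C f Y u)) \<and>
    (\<forall>f g Y u v. cartesian_arrow B C g Y v \<longrightarrow> cartesian_arrow B C f (Dom C v) u \<longrightarrow>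
      cartesian_arrow B C (g \<bullet>\<^bsub>B\<^esub> f) Y (v \<bullet>\<^bsub>C\<^esub> u))"

definition cartesian_functor ::
  "('p, 'b, 'n) cat_scheme \<Rightarrow> ('o, 'a, 'p, 'b, 'm) conc_cat_scheme \<Rightarrow>
   ('q, 'c, 'p, 'b, 'k) conc_cat_scheme \<Rightarrow> ('o, 'a, 'q, 'c) func \<Rightarrow> bool" where
  "cartesian_functor B C D F \<longleftrightarrow> concrete_functor B C D F \<and>
    (\<forall>f Y u. cartesian_arrow B C f Y u \<longrightarrow> cartesian_arrow B D f (fobj F Y) (farr F u))"

text \<open>A choice \<open>\<kappa>\<close> of a cartesian arrow \<open>\<kappa> f Y\<close> for each \<open>f\<close> and \<open>Y\<close>; the domain of
  \<open>\<kappa> f Y\<close> is \<open>f\<^sup>-\<^sup>1(Y)\<close>.\<close>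

definition cleavage ::
  "('p, 'b, 'n) cat_scheme \<Rightarrow> ('o, 'a, 'p, 'b, 'm) conc_cat_scheme \<Rightarrow>
   ('b \<Rightarrow> 'o \<Rightarrow> 'a) \<Rightarrow> bool" where
  "cleavage B C \<kappa> \<longleftrightarrow>
    (\<forall>Y\<in>Obj C. \<forall>f\<in>Arr B. Cod B f = under C Y \<longrightarrow> cartesian_arrow B C f Y (\<kappa> f Y))"

definition inverse_image ::
  "('o, 'a, 'p, 'b, 'm) conc_cat_scheme \<Rightarrow> ('b \<Rightarrow> 'o \<Rightarrow> 'a) \<Rightarrow> 'b \<Rightarrow> 'o \<Rightarrow> 'o" where
  "inverse_image C \<kappa> f Y = Dom C (\<kappa> f Y)"

text \<open>The lifting of \<open>G : D \<rightarrow> R\<close> along a weak left adjoint is the concrete functor \<open>C \<rightarrow> R\<close> with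
  object map \<open>A \<mapsto> \<eta>\<^sub>A\<^sup>-\<^sup>1(G(\<alpha>(A)))\<close>. Faithfulness of the forgetful functor of \<open>R\<close> leaves
  exactly one possible value on each arrow; it exists by \<open>concrete_functor_lifting\<close> below.\<close>

definition lifting ::
  "('o, 'a, 'p, 'b, 'm) conc_cat_scheme \<Rightarrow> ('r, 'd, 'p, 'b, 'k) conc_cat_scheme \<Rightarrow>
   ('b \<Rightarrow> 'r \<Rightarrow> 'd) \<Rightarrow> ('o \<Rightarrow> 'q) \<Rightarrow> ('o \<Rightarrow> 'b) \<Rightarrow> ('q, 'c, 'r, 'd) func \<Rightarrow>
   ('o, 'a, 'r, 'd) func" where
  "lifting C R \<kappa> \<alpha> \<eta> G =
    (let lift = (\<lambda>A. inverse_image R \<kappa> (\<eta> A) (fobj G (\<alpha> A)))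
     in \<lparr>fobj = lift,
         farr = (\<lambda>u. THE v. v \<in> hom R (lift (Dom C u)) (lift (Cod C u)) \<and>
                       farr (Forget R) v = farr (Forget C) u)\<rparr>)"

lemma homD:
  assumes "f \<in> hom C X Y"
  shows "f \<in> Arr C" "X \<in> Obj C" "Y \<in> Obj C" "Dom C f = X" "Cod C f = Y"
  using assms by (auto simp: hom_def)

lemma concrete_functor_under:
  "concrete_functor B C D F \<Longrightarrow> X \<in> Obj C \<Longrightarrow> under D (fobj F X) = under C X"
  using concrete_functor.over_base by (fastforce simp: func_eq_def func_comp_def)

lemma concrete_functor_farr:
  "concrete_functor B C D F \<Longrightarrow> u \<in> Arr C \<Longrightarrow>
    farr (Forget D) (farr F u) = farr (Forget C) u"
  using concrete_functor.over_base by (fastforce simp: func_eq_def func_comp_def)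

lemma concrete_functor_forces:
  assumes F: "concrete_functor B C D F" and "forces C X f Y"
  shows "forces D (fobj F X) f (fobj F Y)"
proof -
  obtain g where g: "g \<in> hom C X Y" "farr (Forget C) g = f"
    using assms(2) by (auto simp: forces_def)
  have "cat_functor C D F"
    using F by (simp add: concrete_functor_def)
  then have "farr F g \<in> hom D (fobj F X) (fobj F Y)"
    using g by (simp add: cat_functor.farr_hom)
  moreover have "farr (Forget D) (farr F g) = f"
    using concrete_functor_farr[OF F] g homD(1) by metis
  ultimately show ?thesis
    by (auto simp: forces_def)
qed

lemma forces_hom:
  assumes "concrete_category B C" "forces C X f Y"
  shows "f \<in> hom B (under C X) (under C Y)"
  using assms cat_functor.farr_hom
  by (fastforce simp: forces_def concrete_category_def)

lemma forces_Comp: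
  assumes C: "concrete_category B C" and "forces C X f Y" "forces C Y g Z"
  shows "forces C X (g \<bullet>\<^bsub>B\<^esub> f) Z"
proof -
  interpret concrete_category B C by (rule C)
  obtain u v where u: "u \<in> hom C X Y" "farr (Forget C) u = f"
    and v: "v \<in> hom C Y Z" "farr (Forget C) v = g"
    using assms by (auto simp: forces_def)
  then have "v \<bullet>\<^bsub>C\<^esub> u \<in> hom C X Z" "farr (Forget C) (v \<bullet>\<^bsub>C\<^esub> u) = g \<bullet>\<^bsub>B\<^esub> f"
    using source.Comp_hom farr_Comp by auto
  then show ?thesis
    by (auto simp: forces_def)
qed

lemma cartesian_arrow_forces:
  assumes C: "concrete_category B C" and "cartesian_arrow B C f Y u"
  shows "forces C (Dom C u) f Y"
proof -
  interpret concrete_category B C by (rule C)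
  show ?thesis
    using assms source.Dom_Obj
    by (force simp: cartesian_arrow_def forces_def hom_def)
qed

lemma cartesian_arrow_lift:
  assumes "cartesian_arrow B C f Y u" "h \<in> hom B (under C Z) (Dom B f)" "Z \<in> Obj C"
    "forces C Z (f \<bullet>\<^bsub>B\<^esub> h) Y"
  shows "forces C Z h (Dom C u)"
  using assms by (auto simp: cartesian_arrow_def)

lemma cartesian_arrow_lifting:
  assumes \<gamma>: "concrete_functor B D C \<gamma>" and G: "concrete_functor B D R G"
    and adj: "weak_left_adjoint B C D \<gamma> \<alpha> \<eta>" and cl: "cleavage B R \<kappa>" and A: "A \<in> Obj C"
  shows "cartesian_arrow B R (\<eta> A) (fobj G (\<alpha> A)) (\<kappa> (\<eta> A) (fobj G (\<alpha> A)))"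
    and "fobj (lifting C R \<kappa> \<alpha> \<eta> G) A = Dom R (\<kappa> (\<eta> A) (fobj G (\<alpha> A)))"
    and "under R (fobj (lifting C R \<kappa> \<alpha> \<eta> G) A) = under C A"
    and "fobj (lifting C R \<kappa> \<alpha> \<eta> G) A \<in> Obj R"
proof -
  interpret G: concrete_functor B D R G by (rule G)
  have \<alpha>: "\<alpha> A \<in> Obj D" and \<eta>: "\<eta> A \<in> hom B (under C A) (under D (\<alpha> A))"
    using adj A by (auto simp: weak_left_adjoint_def)
  show 1: "cartesian_arrow B R (\<eta> A) (fobj G (\<alpha> A)) (\<kappa> (\<eta> A) (fobj G (\<alpha> A)))"
    using cl \<alpha> G.fobj_Obj[OF \<alpha>] homD[OF \<eta>] concrete_functor_under[OF G \<alpha>]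
    by (auto simp: cleavage_def)
  show 2: "fobj (lifting C R \<kappa> \<alpha> \<eta> G) A = Dom R (\<kappa> (\<eta> A) (fobj G (\<alpha> A)))"
    by (simp add: lifting_def inverse_image_def)
  show "under R (fobj (lifting C R \<kappa> \<alpha> \<eta> G) A) = under C A"
    using 1 homD[OF \<eta>] unfolding 2 by (auto simp: cartesian_arrow_def)
  show "fobj (lifting C R \<kappa> \<alpha> \<eta> G) A \<in> Obj R"
    using 1 G.target.source.Dom_Obj unfolding 2 by (auto simp: cartesian_arrow_def)
qed

lemma forces_lifting:
  assumes \<gamma>: "concrete_functor B D C \<gamma>" and G: "concrete_functor B D R G"
    and adj: "weak_left_adjoint B C D \<gamma> \<alpha> \<eta>" and cl: "cleavage B R \<kappa>"
    and f: "forces C X f Y"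
  shows "forces R (fobj (lifting C R \<kappa> \<alpha> \<eta> G) X) f (fobj (lifting C R \<kappa> \<alpha> \<eta> G) Y)"
proof -
  let ?L = "fobj (lifting C R \<kappa> \<alpha> \<eta> G)"
  interpret \<gamma>: concrete_functor B D C \<gamma> by (rule \<gamma>)
  interpret G: concrete_functor B D R G by (rule G)
  have C: "concrete_category B C" and R: "concrete_category B R" by unfold_locales
  have X: "X \<in> Obj C" and Y: "Y \<in> Obj C"
    using f homD by (fastforce simp: forces_def)+
  note LX = cartesian_arrow_lifting[OF \<gamma> G adj cl X]
    and LY = cartesian_arrow_lifting[OF \<gamma> G adj cl Y]
  have \<alpha>Y: "\<alpha> Y \<in> Obj D" and \<eta>Y: "\<eta> Y \<in> hom B (under C Y) (under D (\<alpha> Y))"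
    and "forces C Y (\<eta> Y) (fobj \<gamma> (\<alpha> Y))"
    using adj Y by (auto simp: weak_left_adjoint_def)
  then have *: "forces C X (\<eta> Y \<bullet>\<^bsub>B\<^esub> f) (fobj \<gamma> (\<alpha> Y))"
    using forces_Comp[OF C f] by blast
  have "\<eta> Y \<bullet>\<^bsub>B\<^esub> f \<in> hom B (under C X) (under D (\<alpha> Y))"
    using forces_hom[OF C *] concrete_functor_under[OF \<gamma> \<alpha>Y] by simp
  then obtain f' where f': "forces D (\<alpha> X) f' (\<alpha> Y)" "\<eta> Y \<bullet>\<^bsub>B\<^esub> f = f' \<bullet>\<^bsub>B\<^esub> \<eta> X"
    using adj X \<alpha>Y * unfolding weak_left_adjoint_def by blast
  have "forces R (?L X) (\<eta> X) (fobj G (\<alpha> X))"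
    using cartesian_arrow_forces[OF R LX(1)] LX(2) by simp
  then have "forces R (?L X) (\<eta> Y \<bullet>\<^bsub>B\<^esub> f) (fobj G (\<alpha> Y))"
    using forces_Comp[OF R _ concrete_functor_forces[OF G f'(1)]] f'(2) by simp
  moreover have "f \<in> hom B (under R (?L X)) (Dom B (\<eta> Y))"
    using forces_hom[OF C f] LX(3) homD[OF \<eta>Y] by simp
  ultimately show ?thesis
    using cartesian_arrow_lift[OF LY(1) _ LX(4)] LY(2) by simp
qed

lemma concrete_functor_lifting:
  assumes \<gamma>: "concrete_functor B D C \<gamma>" and G: "concrete_functor B D R G"
    and adj: "weak_left_adjoint B C D \<gamma> \<alpha> \<eta>" and cl: "cleavage B R \<kappa>"
  shows "concrete_functor B C R (lifting C R \<kappa> \<alpha> \<eta> G)"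
proof -
  let ?L = "lifting C R \<kappa> \<alpha> \<eta> G"
  interpret \<gamma>: concrete_functor B D C \<gamma> by (rule \<gamma>)
  interpret G: concrete_functor B D R G by (rule G)
  note cR = G.target.source.Comp_hom and cC = \<gamma>.target.source.Comp_hom
  note L = cartesian_arrow_lifting[OF \<gamma> G adj cl]
  have arr: "farr ?L u \<in> hom R (fobj ?L X) (fobj ?L Y) \<and>
      farr (Forget R) (farr ?L u) = farr (Forget C) u" if u: "u \<in> hom C X Y" for u X Y
  proof -
    have "forces C X (farr (Forget C) u) Y"
      using u by (auto simp: forces_def)
    then obtain v where v: "v \<in> hom R (fobj ?L X) (fobj ?L Y)"
        "farr (Forget R) v = farr (Forget C) u"
      using forces_lifting[OF \<gamma> G adj cl] by (metis forces_def)
    have "farr ?L u = (THE v. v \<in> hom R (fobj ?L X) (fobj ?L Y) \<and>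
        farr (Forget R) v = farr (Forget C) u)"
      using homD[OF u] by (simp add: lifting_def Let_def)
    also have "\<dots> = v"
      using v by (intro the_equality) (auto intro: G.target.faithful)
    finally show ?thesis
      using v by simp
  qed
  show ?thesis
  proof unfold_locales
    fix X assume X: "X \<in> Obj C"
    show "fobj ?L X \<in> Obj R"
      by (rule L(4)[OF X])
    have i: "Ident C X \<in> hom C X X"
      by (rule \<gamma>.target.source.Ident_hom[OF X])
    have "farr (Forget R) (farr ?L (Ident C X)) = farr (Forget R) (Ident R (fobj ?L X))"
      using arr[OF i] \<gamma>.target.farr_Ident[OF X] G.target.farr_Ident[OF L(4)[OF X]] L(3)[OF X]
      by simp
    then show "farr ?L (Ident C X) = Ident R (fobj ?L X)"
      using arr[OF i] G.target.source.Ident_hom[OF L(4)[OF X]] G.target.faithful by blast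
  next
    fix f X Y assume "f \<in> hom C X Y"
    then show "farr ?L f \<in> hom R (fobj ?L X) (fobj ?L Y)"
      using arr by blast
  next
    fix f X Y g Z assume f: "f \<in> hom C X Y" and g: "g \<in> hom C Y Z"
    have "farr (Forget R) (farr ?L (g \<bullet>\<^bsub>C\<^esub> f)) = farr (Forget R) (farr ?L g \<bullet>\<^bsub>R\<^esub> farr ?L f)"
      using arr[OF f] arr[OF g] arr[OF cC[OF f g]] \<gamma>.target.farr_Comp[OF f g]
        G.target.farr_Comp[OF conjunct1[OF arr[OF f]] conjunct1[OF arr[OF g]]] by simp
    then show "farr ?L (g \<bullet>\<^bsub>C\<^esub> f) = farr ?L g \<bullet>\<^bsub>R\<^esub> farr ?L f"
      using arr[OF f] arr[OF g] arr[OF cC[OF f g]] cR G.target.faithful by blast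
  next
    show "func_eq C (Forget C) (func_comp (Forget R) ?L)"
    proof -
      have "farr (Forget R) (farr ?L u) = farr (Forget C) u" if "u \<in> Arr C" for u
        using arr[of u "Dom C u" "Cod C u"] that \<gamma>.target.source.Dom_Obj \<gamma>.target.source.Cod_Obj
        by (simp add: hom_def)
      then show ?thesis
        using L(3) by (simp add: func_eq_def func_comp_def)
    qed
  qed
qed

end

theory Submission
  imports Defs
begin

text \<open>The property of a weak left adjoint descends to the liftings: \<open>A \<tturnstile>\<^sub>f \<gamma>(K)\<close> implies
  \<open>Gbar(A) \<tturnstile>\<^sub>f G(K)\<close>. Applied to \<open>H'(c) \<tturnstile> \<gamma>(H(\<alpha>(c)))\<close> over \<open>\<eta>\<^sub>c\<close>, this and the hypothesis
  for \<open>d = \<alpha>(c)\<close> put an arrow over \<open>\<eta>\<^sub>c\<close> from \<open>F\<^sub>1(Gbar(H'(c)))\<close> to \<open>F\<^sub>2(G(\<alpha>(c)))\<close>, which factors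
  over the identity through the \<open>F\<^sub>2\<close>-image of the cartesian arrow defining \<open>Gbar(c)\<close>.\<close>

lemma forces_lifting_adjoint:
  assumes \<gamma>: "concrete_functor B D C \<gamma>" and G: "concrete_functor B D R G"
    and adj: "weak_left_adjoint B C D \<gamma> \<alpha> \<eta>" and cl: "cleavage B R \<kappa>"
    and K: "K \<in> Obj D" and f: "forces C A f (fobj \<gamma> K)"
  shows "forces R (fobj (lifting C R \<kappa> \<alpha> \<eta> G) A) f (fobj G K)"
proof -
  interpret \<gamma>: concrete_functor B D C \<gamma> by (rule \<gamma>)
  interpret G: concrete_functor B D R G by (rule G)
  have C: "concrete_category B C" and R: "concrete_category B R" by unfold_locales
  have A: "A \<in> Obj C"
    using f homD by (fastforce simp: forces_def)
  have "f \<in> hom B (under C A) (under D K)"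
    using forces_hom[OF C f] concrete_functor_under[OF \<gamma> K] by simp
  \<comment> \<open>\<open>G\<close> cannot be applied to an arrow of \<open>C\<close>. The weak
    adjunction replaces \<open>f\<close> by \<open>f'\<close>, which is realized in \<open>D\<close>
    and so survives \<open>G\<close>; the remaining factor \<open>\<eta> A\<close> is covered by the
    cartesian arrow that defines the lifting at \<open>A\<close>.\<close>
  then obtain f' where f': "forces D (\<alpha> A) f' K" "f = f' \<bullet>\<^bsub>B\<^esub> \<eta> A"
    using adj A K f unfolding weak_left_adjoint_def by blast
  note L = cartesian_arrow_lifting[OF \<gamma> G adj cl A]
  have "forces R (fobj (lifting C R \<kappa> \<alpha> \<eta> G) A) (\<eta> A) (fobj G (\<alpha> A))"
    using cartesian_arrow_forces[OF R L(1)] L(2) by simp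
  then show ?thesis
    using forces_Comp[OF R _ concrete_functor_forces[OF G f'(1)]] f'(2) by simp
qed

text \<open>The universal property of \<open>farr F u\<close> speaks of its domain in
  \<open>D\<close>. The second equation identifies that domain with the \<open>F\<close>-image of
  the domain of \<open>u\<close>, so that lifts end in the image of an inverse image.\<close>

lemma cartesian_functor_arrow:
  assumes F: "cartesian_functor B C D F" and u: "cartesian_arrow B C f Y u"
  shows "cartesian_arrow B D f (fobj F Y) (farr F u)"
    and "Dom D (farr F u) = fobj F (Dom C u)"
proof -
  interpret concrete_functor B C D F
    using F by (simp add: cartesian_functor_def)
  show "cartesian_arrow B D f (fobj F Y) (farr F u)"
    using F u by (simp add: cartesian_functor_def)
  have "u \<in> hom C (Dom C u) (Cod C u)"
    using u source.source.Dom_Obj source.source.Cod_Obj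
    by (auto simp: cartesian_arrow_def hom_def)
  then show "Dom D (farr F u) = fobj F (Dom C u)"
    by (rule homD(4)[OF farr_hom])
qed

theorem theorem3:
  fixes B :: "('bo, 'ba, 'bm) cat_scheme"
    and C :: "('co, 'ca, 'bo, 'ba, 'cm) conc_cat_scheme"
    and D :: "('do, 'da, 'bo, 'ba, 'dm) conc_cat_scheme"
    and R :: "('ro, 'ra, 'bo, 'ba, 'rm) conc_cat_scheme"
    and R' :: "('so, 'sa, 'bo, 'ba, 'sm) conc_cat_scheme"
    and \<gamma> :: "('do, 'da, 'co, 'ca) func"
    and \<alpha> :: "'co \<Rightarrow> 'do" and \<eta> :: "'co \<Rightarrow> 'ba"
    and H :: "('do, 'da, 'do, 'da) func"
    and H' :: "('co, 'ca, 'co, 'ca) func"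
    and G :: "('do, 'da, 'ro, 'ra) func"
    and F\<^sub>1 F\<^sub>2 :: "('ro, 'ra, 'so, 'sa) func"
    and \<kappa> :: "'ba \<Rightarrow> 'ro \<Rightarrow> 'ra"
  assumes "category B"
    and "concrete_category B C" and "concrete_category B D"
    and "concrete_category B R" and "concrete_category B R'"
    and "concrete_functor B D C \<gamma>" and "weak_left_adjoint B C D \<gamma> \<alpha> \<eta>"
    and "concrete_functor B D D H" and "concrete_functor B C C H'"
    and "func_eq D (func_comp H' \<gamma>) (func_comp \<gamma> H)"
    and "concrete_functor B D R G"
    and "concrete_functor B R R' F\<^sub>1" and "concrete_functor B R R' F\<^sub>2"
    and "fibred B R" and "cleavage B R \<kappa>"
    and "cartesian_functor B R R' F\<^sub>2"
    and "\<forall>d\<in>Obj D. below B R' (fobj F\<^sub>1 (fobj G (fobj H d))) (fobj F\<^sub>2 (fobj G d))"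
  shows "let Gbar = lifting C R \<kappa> \<alpha> \<eta> G
    in \<forall>c\<in>Obj C. below B R' (fobj F\<^sub>1 (fobj Gbar (fobj H' c))) (fobj F\<^sub>2 (fobj Gbar c))"
proof -
  note B = assms(1) and C = assms(2) and R' = assms(5) and \<gamma> = assms(6) and adj = assms(7)
    and H = assms(8) and H' = assms(9) and comm = assms(10) and G = assms(11)
    and F1 = assms(12) and F2 = assms(13) and cl = assms(15) and cart = assms(16)
    and le = assms(17)
  let ?L = "fobj (lifting C R \<kappa> \<alpha> \<eta> G)"
  interpret H: concrete_functor B D D H by (rule H)
  interpret H': concrete_functor B C C H' by (rule H')
  interpret F1: concrete_functor B R R' F\<^sub>1 by (rule F1)
  have "below B R' (fobj F\<^sub>1 (?L (fobj H' c))) (fobj F\<^sub>2 (?L c))" if c: "c \<in> Obj C" for c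
  proof -
    have \<alpha>: "\<alpha> c \<in> Obj D" and \<eta>: "\<eta> c \<in> hom B (under C c) (under D (\<alpha> c))"
      and unit: "forces C c (\<eta> c) (fobj \<gamma> (\<alpha> c))"
      using adj c by (auto simp: weak_left_adjoint_def)
    have H'c: "fobj H' c \<in> Obj C" by (rule H'.fobj_Obj[OF c])
    note L = cartesian_arrow_lifting[OF \<gamma> G adj cl c]
      and L' = cartesian_arrow_lifting[OF \<gamma> G adj cl H'c]
    let ?X = "fobj F\<^sub>1 (?L (fobj H' c))" and ?Y = "fobj F\<^sub>2 (?L c)"
    have X: "?X \<in> Obj R'" by (rule F1.fobj_Obj[OF L'(4)])
    have uX: "under R' ?X = under C c"
      using concrete_functor_under[OF F1 L'(4)] concrete_functor_under[OF H' c] L'(3) by simp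
    have uY: "under R' ?Y = under C c"
      using concrete_functor_under[OF F2 L(4)] L(3) by simp
    \<comment> \<open>Applying \<open>H'\<close> keeps \<eta> at \<open>c\<close> as the underlying
      arrow, and the commutation moves the target back into the image of \<gamma>. This allows
      \<open>K\<close> to be \<open>fobj H (\<alpha> c)\<close>.\<close>
    have "fobj H' (fobj \<gamma> (\<alpha> c)) = fobj \<gamma> (fobj H (\<alpha> c))"
      using comm \<alpha> by (simp add: func_eq_def func_comp_def)
    then have "forces C (fobj H' c) (\<eta> c) (fobj \<gamma> (fobj H (\<alpha> c)))"
      using concrete_functor_forces[OF H' unit] by simp
    then have "forces R (?L (fobj H' c)) (\<eta> c) (fobj G (fobj H (\<alpha> c)))"
      by (rule forces_lifting_adjoint[OF \<gamma> G adj cl H.fobj_Obj[OF \<alpha>]])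
    then have 1: "forces R' ?X (\<eta> c) (fobj F\<^sub>1 (fobj G (fobj H (\<alpha> c))))" (is "forces _ _ _ ?Z")
      by (rule concrete_functor_forces[OF F1])
    have 2: "forces R' ?Z (Ident B (under R' ?Z)) (fobj F\<^sub>2 (fobj G (\<alpha> c)))"
      using le \<alpha> unfolding below_def by blast
    \<comment> \<open>The inequality at \<open>\<alpha> c\<close> lies over an identity, so
      composing with it changes the target but not the base arrow.\<close>
    have "forces R' ?X (\<eta> c) (fobj F\<^sub>2 (fobj G (\<alpha> c)))"
      using forces_Comp[OF R' 1 2] category.Ident_Comp[OF B forces_hom[OF R' 1]] by simp
    \<comment> \<open>Splitting off an identity on the right gives the form that the cartesian lift
      expects, with the identity as the arrow to be lifted; its lift is the desired
      inequality.\<close>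
    then have "forces R' ?X (\<eta> c \<bullet>\<^bsub>B\<^esub> Ident B (under C c)) (fobj F\<^sub>2 (fobj G (\<alpha> c)))"
      using category.Comp_Ident[OF B \<eta>] by simp
    moreover have "Ident B (under C c) \<in> hom B (under R' ?X) (Dom B (\<eta> c))"
      using category.Ident_hom[OF B homD(2)[OF \<eta>]] uX homD(4)[OF \<eta>] by simp
    ultimately have "forces R' ?X (Ident B (under C c)) ?Y"
      using cartesian_arrow_lift[OF cartesian_functor_arrow(1)[OF cart L(1)] _ X]
        cartesian_functor_arrow(2)[OF cart L(1)] L(2) by simp
    then show ?thesis
      using uX uY by (simp add: below_def)
  qed
  then show ?thesis
    by (simp add: Let_def)
qed

end
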